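(* Let $p\ge5$ be a prime number and let $n:=2^{p-1}$. The number $2^p-1$ is prime if and only if $$2n-1\;\Big|\;\frac{\Omega_0(\lfloor n/2\rfloor\,|\,1,4\,|\,n)}{(n-1)(n-2)\cdots(n-\lfloor n/2\rfloor)} .$$
   Context: For a natural number $m$, $\delta(m)\in\{0,1\}$ denotes $m\bmod 2$. Divisibility is in the integers (the ratio on the right is an integer). The Quanta Prime Sequence $\Omega_r(k|\zeta,\xi|n)$ associated with $n$ and a point $(\zeta,\xi)\ne(0,0)$ is defined for integers $r,k\ge0$ with $r+k\le\lfloor n/2\rfloor$ by $\Omega_r(0|\zeta,\xi|n)=1$ for all $r$, and for $k\ge1$ $$\Omega_r(k|\zeta,\xi|n)=(2\zeta-\xi)(n-r-k)\,\Omega_r(k-1|\zeta,\xi|n)-2\zeta\,(n-2r-\delta(n-1))\,\Omega_{r+1}(k-1|\zeta,\xi|n).$$ *)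

theory Defs
  imports "HOL-Computational_Algebra.Primes"
begin

definition parity_bit :: "nat \<Rightarrow> nat" where
  "parity_bit m = m mod 2"

text \<open>
  \<open>quanta_prime r k \<zeta> \<xi> n\<close> is the Quanta Prime Sequence \<open>\<Omega>\<^sub>r(k | \<zeta>, \<xi> | n)\<close>
  associated with \<open>n\<close> and a point \<open>(\<zeta>, \<xi>) \<noteq> (0, 0)\<close>.  It is meaningful for
  \<open>r + k \<le> n div 2\<close>.  The recurrence never leaves this range, so using the same equations to
  totalise the function outside of it does not affect the values inside.
  All subtractions in the coefficients are carried out in the ring, except \<open>n - 1\<close>, where
  truncation could matter only for \<open>n = 0\<close>, and then the second equation is outside the range.
\<close>

primrec quanta_prime :: "nat \<Rightarrow> nat \<Rightarrow> 'a::comm_ring_1 \<Rightarrow> 'a \<Rightarrow> nat \<Rightarrow> 'a" where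
  "quanta_prime r 0 \<zeta> \<xi> n = 1"
| "quanta_prime r (Suc k) \<zeta> \<xi> n =
     (2 * \<zeta> - \<xi>) * (of_nat n - of_nat r - of_nat (Suc k)) * quanta_prime r k \<zeta> \<xi> n
     - 2 * \<zeta> * (of_nat n - 2 * of_nat r - of_nat (parity_bit (n - 1)))
         * quanta_prime (Suc r) k \<zeta> \<xi> n"

end

theory Submission
  imports Defs "HOL-Number_Theory.Number_Theory"
begin

text \<open>
  The recurrence has the closed form
  \<open>\<Omega>\<^sub>r(k) = (\<Sum>i\<le>k. C(k,i) \<alpha>\<^sup>k\<^sup>-\<^sup>i \<beta>\<^sup>i (\<Prod>j<i. n - 2r - 1 - 2j) (\<Prod>i<j\<le>k. n - r - j))\<close> for even \<open>n\<close>,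
  with \<open>\<alpha> = 2\<zeta> - \<xi>\<close> and \<open>\<beta> = -2\<zeta>\<close>. For \<open>r = 0\<close> and \<open>n = 2k\<close>, division by the product
  \<open>(n - 1) \<dots> (n - k)\<close> turns the coefficients into those of the Girard-Waring formula for
  \<open>u\<^sup>n + v\<^sup>n\<close> with \<open>(u - v)\<^sup>2 = \<alpha>\<close> and \<open>uv = \<beta>/2\<close>. At \<open>(1,4)\<close> this gives
  \<open>u\<^sup>2 + v\<^sup>2 = -4\<close> and \<open>u\<^sup>2v\<^sup>2 = 1\<close>, so the ratio is, up to sign, the Lucas-Lehmer number
  \<open>\<omega>\<^sup>k + \<omega>\<^sup>-\<^sup>k\<close> with \<open>\<omega> = 2 + \<surd>3\<close> and \<open>k = 2\<^sup>p\<^sup>-\<^sup>2\<close>.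

  For the Lucas-Lehmer test, write \<open>\<omega>\<^sup>k = x + y\<surd>3\<close>. If \<open>q = 2\<^sup>p - 1\<close> is prime, then 3 is a
  non-residue modulo \<open>q\<close>, so \<open>(1 + \<surd>3)\<^sup>q \<equiv> 1 - \<surd>3\<close>; since \<open>(1 + \<surd>3)\<^sup>2 = 2\<omega>\<close>, this gives
  \<open>\<omega>\<^sup>2\<^sup>k \<equiv> -1\<close>, which amounts to \<open>q\<close> dividing \<open>x\<close>. Conversely, if \<open>2\<^sup>p - 1\<close> divides \<open>x\<close>,
  then \<open>\<omega>\<close> has order \<open>2\<^sup>p\<close> modulo each prime factor \<open>q\<close>, so that \<open>2\<^sup>p \<le> q\<^sup>2\<close>,
  and \<open>2\<^sup>p - 1\<close> has no prime factor up to its square root.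
\<close>

section \<open>Powers in \<int>[\<surd>3]\<close>

text \<open>Integer coordinates: \<open>(a + b\<surd>3)\<^sup>k = re3 a b k + im3 a b k \<surd>3\<close>.\<close>

fun re3 im3 :: "int \<Rightarrow> int \<Rightarrow> nat \<Rightarrow> int" where
  "re3 a b 0 = 1"
| "im3 a b 0 = 0"
| "re3 a b (Suc k) = a * re3 a b k + 3 * b * im3 a b k"
| "im3 a b (Suc k) = a * im3 a b k + b * re3 a b k"

lemma re3_im3_add:
  "re3 a b (m + k) = re3 a b m * re3 a b k + 3 * im3 a b m * im3 a b k"
  "im3 a b (m + k) = im3 a b m * re3 a b k + re3 a b m * im3 a b k"
  by (induction m) (simp_all add: algebra_simps)

lemma norm_re3_im3: "(re3 a b k)\<^sup>2 - 3 * (im3 a b k)\<^sup>2 = (a\<^sup>2 - 3 * b\<^sup>2) ^ k"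
proof (induction k)
  case (Suc k)
  have "(re3 a b (Suc k))\<^sup>2 - 3 * (im3 a b (Suc k))\<^sup>2
      = (a\<^sup>2 - 3 * b\<^sup>2) * ((re3 a b k)\<^sup>2 - 3 * (im3 a b k)\<^sup>2)"
    by (simp add: power2_eq_square algebra_simps)
  then show ?case using Suc by simp
qed simp

lemma pell_norm: "re3 2 1 k * re3 2 1 k - 3 * (im3 2 1 k * im3 2 1 k) = 1"
  using norm_re3_im3[of 2 1 k] by (simp add: power2_eq_square)

lemma re3_double: "re3 2 1 (2 * k) = 2 * (re3 2 1 k)\<^sup>2 - 1"
  unfolding mult_2[of k] re3_im3_add using pell_norm[of k] by (simp add: power2_eq_square)

lemma im3_double: "im3 a b (2 * k) = 2 * re3 a b k * im3 a b k"
  unfolding mult_2[of k] re3_im3_add by simp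

section \<open>Powers of 1 + \<surd>3 and their residues modulo a prime\<close>

lemma re3_im3_one_double:
  "re3 1 1 (2 * k) = 2 ^ k * re3 2 1 k \<and> im3 1 1 (2 * k) = 2 ^ k * im3 2 1 k"
  by (induction k) (simp_all add: algebra_simps)

text \<open>Pascal's rule termwise. A bound \<open>N\<close> not tied to \<open>k\<close> keeps the
  summation range fixed during the induction; terms beyond \<open>k\<close> are zero.\<close>

lemma re3_im3_one_binomial:
  "k \<le> 2 * N \<Longrightarrow> re3 1 1 k = (\<Sum>i\<le>N. int (k choose (2 * i)) * 3 ^ i) \<and>
    im3 1 1 k = (\<Sum>i\<le>N. int (k choose (2 * i + 1)) * 3 ^ i)"
proof (induction k)
  case 0
  have "(\<Sum>i\<le>N. int (0 choose (2 * i)) * 3 ^ i) = (\<Sum>i\<in>{0::nat}. int (0 choose (2 * i)) * 3 ^ i)"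
    by (rule sum.mono_neutral_right) auto
  then show ?case by simp
next
  case (Suc k)
  then have IH: "re3 1 1 k = (\<Sum>i\<le>N. int (k choose (2 * i)) * 3 ^ i)"
    "im3 1 1 k = (\<Sum>i\<le>N. int (k choose (2 * i + 1)) * 3 ^ i)" by simp_all
  have im: "im3 1 1 (Suc k) = (\<Sum>i\<le>N. int (Suc k choose (2 * i + 1)) * 3 ^ i)"
    using IH by (simp add: sum.distrib[symmetric] algebra_simps)
  obtain N' where N: "N = Suc N'" using Suc.prems by (cases N) auto
  have top: "k choose (2 * N + 1) = 0" using Suc.prems by (simp add: binomial_eq_0)
  have "(\<Sum>i\<le>N. int (Suc k choose (2 * i)) * 3 ^ i)
      = 1 + (\<Sum>i\<le>N'. int (Suc k choose (2 * i + 2)) * 3 ^ Suc i)"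
    unfolding N by (subst sum.atMost_Suc_shift) simp
  also have "\<dots> = 1 + (\<Sum>i\<le>N'. int (k choose (2 * i + 2)) * 3 ^ Suc i)
      + 3 * (\<Sum>i\<le>N'. int (k choose (2 * i + 1)) * 3 ^ i)"
    by (simp add: sum.distrib sum_distrib_left algebra_simps)
  also have "1 + (\<Sum>i\<le>N'. int (k choose (2 * i + 2)) * 3 ^ Suc i) = re3 1 1 k"
    unfolding IH(1) N by (subst sum.atMost_Suc_shift) simp
  also have "(\<Sum>i\<le>N'. int (k choose (2 * i + 1)) * 3 ^ i) = im3 1 1 k"
    unfolding IH(2) using top unfolding N by simp
  finally show ?case using im by simp
qed

text \<open>Frobenius: \<open>q\<close> divides every inner binomial coefficient, so only the two
  end terms of the expansion survive.\<close>

lemma re3_im3_one_prime: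
  fixes q :: nat
  assumes "prime q" "odd q"
  shows "[re3 1 1 q = 1] (mod int q)" "[im3 1 1 q = 3 ^ ((q - 1) div 2)] (mod int q)"
proof -
  define e where "e = (q - 1) div 2"
  have q: "q = 2 * e + 1" using assms(2) unfolding e_def by (auto elim: oddE)
  have e: "0 < e" using assms(1) q by (cases e) auto
  have dvd: "[int (q choose j) * 3 ^ i = 0] (mod int q)" if "0 < j" "j < q" for i j
  proof -
    have "q dvd (q choose j)" using that assms(1) by (intro dvd_choose_prime) auto
    then show ?thesis by (simp add: cong_0_iff)
  qed
  have "re3 1 1 q = (\<Sum>i\<le>Suc e. int (q choose (2 * i)) * 3 ^ i)"
    using re3_im3_one_binomial[of q "Suc e"] q by simp
  also have "\<dots> = (\<Sum>i\<le>e. int (q choose (2 * i)) * 3 ^ i)"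
    by (simp add: q binomial_eq_0)
  also have "\<dots> = 1 + (\<Sum>i\<in>{..e} - {0}. int (q choose (2 * i)) * 3 ^ i)"
    by (subst sum.remove[of _ 0]) auto
  also have "[\<dots> = 1 + (\<Sum>i\<in>{..e} - {0}. 0)] (mod int q)"
    by (intro cong_add cong_refl cong_sum dvd) (auto simp: q)
  finally show "[re3 1 1 q = 1] (mod int q)" by simp
  have "im3 1 1 q = (\<Sum>i\<le>Suc e. int (q choose (2 * i + 1)) * 3 ^ i)"
    using re3_im3_one_binomial[of q "Suc e"] q by simp
  also have "\<dots> = 3 ^ e + (\<Sum>i<e. int (q choose (2 * i + 1)) * 3 ^ i)"
    by (simp add: q binomial_eq_0 flip: lessThan_Suc_atMost)
  also have "[\<dots> = 3 ^ e + (\<Sum>i<e. 0)] (mod int q)"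
    by (intro cong_add cong_refl cong_sum dvd) (auto simp: q)
  finally show "[im3 1 1 q = 3 ^ ((q - 1) div 2)] (mod int q)" by (simp add: e_def)
qed

section \<open>Lucas-Lehmer test: necessity\<close>

lemma pow2_mod_3: "odd p \<Longrightarrow> (2::int) ^ p mod 3 = 2"
proof -
  assume "odd p"
  then obtain k where "p = 2 * k + 1" by (auto elim: oddE)
  moreover have "[(4::int) ^ k = 1 ^ k] (mod 3)" by (intro cong_pow) (simp add: cong_def)
  then have "[2 * (4::int) ^ k = 2 * 1 ^ k] (mod 3)" by (rule cong_mult[OF cong_refl])
  ultimately show ?thesis by (simp add: power_mult cong_def)
qed

text \<open>\<open>q\<close> is 1 modulo 3 because \<open>p\<close> is odd, and 3 modulo 4 because 4
  divides \<open>2 ^ p\<close>; reciprocity gives (3/q) = -(q/3) = -1.\<close>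

lemma three_euler_mersenne:
  fixes q :: nat
  assumes "prime q" and q: "q = 2 ^ p - 1" and "odd p" "3 \<le> p"
  shows "[3 ^ ((q - 1) div 2) = - 1] (mod int q)"
proof -
  have "(2::nat) ^ 3 \<le> 2 ^ p" using assms(4) by (intro power_increasing) auto
  then have q7: "7 \<le> q" using q by simp
  have qi: "int q = 2 ^ p - 1" using q by (simp add: of_nat_diff)
  have "(int q - 1) mod 3 = (2 ^ p - 2) mod 3" using qi by simp
  also have "\<dots> = 0" using pow2_mod_3[OF assms(3)] by (metis cong_0_iff cong_def cong_iff_dvd_diff dvd_imp_mod_0 mod_mod_trivial)
  finally have q3: "[int q = 1] (mod 3)" by (simp add: cong_iff_dvd_diff mod_0_imp_dvd)
  have L1: "Legendre (int q) 3 = 1"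
  proof -
    have "\<not> [int q = 0] (mod 3)" using q3 by (simp add: cong_def)
    moreover have "QuadRes 3 (int q)" unfolding QuadRes_def
      using q3 by (intro exI[of _ 1]) (simp add: cong_sym)
    ultimately show ?thesis by (simp add: Legendre_def)
  qed
  obtain r where r: "p = Suc (Suc r)" using assms(4) by (cases p; cases "p - 1") auto
  have "(q - 1) div 2 = 2 * 2 ^ r - 1" using q r by simp
  then have od: "odd ((q - 1) div 2)" by simp
  have "Legendre 3 (int q) * Legendre (int q) 3 = (-1) ^ ((3 - 1) div 2 * ((q - 1) div 2))"
    using Quadratic_Reciprocity[of 3 q] assms(1) q7 by simp
  then have "Legendre 3 (int q) = -1" using L1 od by simp
  then show ?thesis using euler_criterion[of q 3] assms(1) q7 by (simp add: cong_sym)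
qed

lemma lucas_lehmer_necessary:
  fixes q :: nat
  assumes "prime q" and q: "q = 2 ^ p - 1" and "prime p" "odd p"
  shows "int q dvd re3 2 1 (2 ^ (p - 2))"
proof -
  have p3: "3 \<le> p" using prime_ge_2_nat[OF assms(3)] assms(4) by (cases "p = 2") auto
  define m where "m = (2::nat) ^ (p - 1)"
  have "2 ^ p = 2 * m" using p3 by (simp add: m_def flip: power_Suc)
  then have qm: "q = 2 * m - 1" using q by simp
  have m1: "1 \<le> m" by (simp add: m_def)
  have "odd q" using qm m1 by simp
  \<comment> \<open>Since \<open>2 * m = q + 1\<close>, the power is congruent to the norm (1 -
    \<surd>3)(1 + \<surd>3) = -2.\<close>
  have "re3 1 1 (2 * m) = re3 1 1 q + 3 * im3 1 1 q"
    using qm m1 by (cases "2 * m") auto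
  also have "[\<dots> = 1 + 3 * (-1)] (mod int q)"
    using re3_im3_one_prime[OF assms(1) \<open>odd q\<close>] three_euler_mersenne[OF assms(1) q assms(4) p3]
    by (intro cong_add cong_mult cong_refl) (auto intro: cong_trans)
  finally have 1: "[2 ^ m * re3 2 1 m = -2] (mod int q)"
    using re3_im3_one_double[of m] by simp
  \<comment> \<open>To remove the factor \<open>2 ^ m\<close>: Fermat makes \<open>p\<close> divide
    \<open>m - 1\<close>, and \<open>2 ^ p\<close> is 1 modulo \<open>q\<close>, so
    \<open>2 ^ m\<close> is 2.\<close>
  have "\<not> p dvd 2" using p3 by (auto dest: dvd_imp_le)
  then have "[2 ^ (p - 1) = 1] (mod p)" by (rule fermat_theorem[OF assms(3)])
  then have "p dvd m - 1" using m1 by (simp add: m_def cong_altdef_nat)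
  then obtain t where t: "m - 1 = p * t" by blast
  have qi: "int q = 2 ^ p - 1" using q by (simp add: of_nat_diff)
  have "[(2::int) ^ p = 1] (mod int q)" unfolding qi by (simp add: cong_iff_dvd_diff)
  then have "[((2::int) ^ p) ^ t = 1 ^ t] (mod int q)" by (rule cong_pow)
  then have "[2 * (2::int) ^ (m - 1) = 2 * 1] (mod int q)"
    unfolding t power_mult power_one by (rule cong_mult[OF cong_refl])
  then have 2: "[2 ^ m = (2::int)] (mod int q)" using m1 by (simp flip: power_Suc)
  have "[2 * re3 2 1 m = -2] (mod int q)"
    using cong_mult[OF cong_sym[OF 2] cong_refl] 1 cong_trans by blast
  then have "int q dvd 2 * (re3 2 1 m + 1)" by (simp add: cong_iff_dvd_diff algebra_simps)
  \<comment> \<open>Halving the exponent turns \<open>2 * (re3 2 1 m + 1)\<close> into four times a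
    square.\<close>
  moreover have "re3 2 1 m = 2 * (re3 2 1 (2 ^ (p - 2)))\<^sup>2 - 1"
  proof -
    have "m = 2 * 2 ^ (p - 2)" using p3 by (simp add: m_def Suc_diff_le flip: power_Suc)
    then show ?thesis using re3_double by simp
  qed
  ultimately have "int q dvd 2 ^ 2 * (re3 2 1 (2 ^ (p - 2)))\<^sup>2" by simp
  moreover have "coprime (int q) (2 ^ 2)"
    unfolding coprime_power_right_iff using \<open>odd q\<close> by simp
  ultimately have "int q dvd (re3 2 1 (2 ^ (p - 2)))\<^sup>2" by (simp add: coprime_dvd_mult_right_iff)
  then show ?thesis using assms(1) prime_dvd_power by (metis prime_nat_int_transfer)
qed

section \<open>Lucas-Lehmer test: sufficiency\<close>

lemma pell_multiple:
  assumes x: "[re3 2 1 m = e] (mod Q)" and y: "[im3 2 1 m = 0] (mod Q)"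
  shows "[re3 2 1 (m * k) = e ^ k] (mod Q) \<and> [im3 2 1 (m * k) = 0] (mod Q)"
proof (induction k)
  case (Suc k)
  have "[re3 2 1 (m + m * k) = e * e ^ k + 3 * 0 * 0] (mod Q)"
    unfolding re3_im3_add using Suc x y by (intro cong_add cong_mult cong_refl) auto
  moreover have "[im3 2 1 (m + m * k) = 0 * e ^ k + e * 0] (mod Q)"
    unfolding re3_im3_add using Suc x y by (intro cong_add cong_mult cong_refl) auto
  ultimately show ?case by simp
qed simp

text \<open>\<omega>^m has norm 1, so its conjugate is its inverse; multiplying by the conjugate
  cancels it modulo any \<open>Q\<close>.\<close>

lemma pell_cancel:
  assumes x: "[re3 2 1 (m + d) = re3 2 1 m] (mod Q)" and y: "[im3 2 1 (m + d) = im3 2 1 m] (mod Q)"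
  shows "[re3 2 1 d = 1] (mod Q)" "[im3 2 1 d = 0] (mod Q)"
proof -
  let ?a = "re3 2 1 m" and ?b = "im3 2 1 m" and ?c = "re3 2 1 d" and ?d = "im3 2 1 d"
  have N: "?a * ?a - 3 * (?b * ?b) = 1" by (rule pell_norm)
  have "[?a * re3 2 1 (m + d) - 3 * ?b * im3 2 1 (m + d) = ?a * ?a - 3 * ?b * ?b] (mod Q)"
    by (intro cong_diff cong_mult cong_refl x y)
  moreover have "?a * re3 2 1 (m + d) - 3 * ?b * im3 2 1 (m + d) = (?a * ?a - 3 * (?b * ?b)) * ?c"
    unfolding re3_im3_add by (simp add: algebra_simps)
  ultimately show "[?c = 1] (mod Q)" using N by (simp add: mult.assoc)
  have "[?a * im3 2 1 (m + d) - ?b * re3 2 1 (m + d) = ?a * ?b - ?b * ?a] (mod Q)"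
    by (intro cong_diff cong_mult cong_refl x y)
  moreover have "?a * im3 2 1 (m + d) - ?b * re3 2 1 (m + d) = (?a * ?a - 3 * (?b * ?b)) * ?d"
    unfolding re3_im3_add by (simp add: algebra_simps)
  ultimately show "[?d = 0] (mod Q)" using N by simp
qed

lemma composite_small_prime_factor:
  fixes M :: nat
  assumes "\<not> prime M" "1 < M"
  obtains q where "prime q" "q dvd M" "q * q \<le> M"
proof -
  obtain a b where ab: "M = a * b" "a \<noteq> 1" "b \<noteq> 1" "a \<le> b"
  proof -
    obtain a where a: "a dvd M" "a \<noteq> 1" "a \<noteq> M" using assms prime_nat_iff by auto
    then obtain b where b: "M = a * b" by blast
    then have "b \<noteq> 1" using a by auto
    with a b that[of a b] that[of b a] show ?thesis by (cases "a \<le> b") (auto simp: mult.commute)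
  qed
  obtain q where q: "prime q" "q dvd a" using ab(2) prime_factor_nat by blast
  have "0 < a" using ab assms by (cases a) auto
  then have "q \<le> a" using q dvd_imp_le by blast
  then have "q * q \<le> M" using ab by (simp add: mult_le_mono)
  with q ab that show ?thesis by auto
qed

lemma lucas_lehmer_sufficient:
  assumes p: "2 \<le> p" and dvd: "int (2 ^ p - 1) dvd re3 2 1 (2 ^ (p - 2))"
  shows "prime (2 ^ p - 1 :: nat)"
proof (rule ccontr)
  assume "\<not> prime (2 ^ p - 1 :: nat)"
  moreover have "(2::nat) ^ 2 \<le> 2 ^ p" using p by (intro power_increasing) auto
  then have M1: "1 < (2 ^ p - 1 :: nat)" by simp
  ultimately obtain q :: nat where q: "prime q" "q dvd 2 ^ p - 1" "q * q \<le> 2 ^ p - 1"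
    by (rule composite_small_prime_factor)
  let ?Q = "int q"
  have "odd (2 ^ p - 1 :: nat)" using p by simp
  with q(2) have "odd q" using dvd_trans by blast
  define m where "m = (2::nat) ^ (p - 1)"
  have m: "m = 2 * 2 ^ (p - 2)" using p by (simp add: m_def Suc_diff_le flip: power_Suc)
  have h: "?Q dvd re3 2 1 (2 ^ (p - 2))" using q(2) dvd by (meson dvd_trans int_dvd_int_iff)
  have m_re: "[re3 2 1 m = -1] (mod ?Q)"
    unfolding m re3_double using h by (simp add: cong_iff_dvd_diff power2_eq_square)
  have m_im: "[im3 2 1 m = 0] (mod ?Q)"
    unfolding m im3_double using h by (simp add: cong_iff_dvd_diff)
  \<comment> \<open>Pigeonhole in place of group orders: \<open>2 ^ p\<close> exponents meet only
    q^2 < 2^p residue pairs, so \<omega>^d is 1 for some \<open>d\<close> with 0 < d < 2^p.\<close>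
  define f where "f = (\<lambda>k. (re3 2 1 k mod ?Q, im3 2 1 k mod ?Q))"
  have "card ({0..<?Q} \<times> {0..<?Q}) = q * q" by simp
  also have "\<dots> < card {..<(2::nat) ^ p}" using q(3) M1 by simp
  finally have "card ({0..<?Q} \<times> {0..<?Q}) < card {..<(2::nat) ^ p}" .
  moreover have "f ` {..<(2::nat) ^ p} \<subseteq> {0..<?Q} \<times> {0..<?Q}"
    using q(1) by (auto simp: f_def prime_gt_0_nat)
  ultimately have "\<not> inj_on f {..<(2::nat) ^ p}"
    using card_inj_on_le[of f "{..<(2::nat) ^ p}" "{0..<?Q} \<times> {0..<?Q}"] by auto
  then obtain i j where ij: "f i = f j" "i \<noteq> j" "i < 2 ^ p" "j < 2 ^ p"
    unfolding inj_on_def by auto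
  then obtain i d where id: "f (i + d) = f i" "0 < d" "d < 2 ^ p"
  proof (cases "i < j")
    case True
    with ij that[of i "j - i"] show ?thesis by auto
  next
    case False
    with ij that[of j "i - j"] show ?thesis by auto
  qed
  have d: "[re3 2 1 d = 1] (mod ?Q)" "[im3 2 1 d = 0] (mod ?Q)"
    using pell_cancel[of i d ?Q] id(1) by (auto simp: f_def cong_def)
  \<comment> \<open>With \<open>t\<close> the odd part of \<open>d\<close>, \<open>m * t\<close> is
    a multiple of \<open>d\<close> since \<open>a < p\<close>. So \<omega>^(mt) is both (-1)^t = -1
    and 1, which forces \<open>q dvd 2\<close>.\<close>
  obtain a t where at: "d = 2 ^ a * t" "odd t"
    using id(2) by (metis multiplicity_decompose' odd_one not_is_unit_0 bot_nat_0.not_eq_extremum prime_elem_multiplicity_mult_distrib)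
  have "2 ^ a \<le> d" using at id(2) by (cases t) auto
  then have "(2::nat) ^ a < 2 ^ p" using id(3) by (rule le_less_trans)
  then have "a < p" by simp
  then have "m = 2 ^ a * 2 ^ (p - 1 - a)" unfolding m_def by (simp flip: power_add)
  then have "m * t = d * 2 ^ (p - 1 - a)" using at by simp
  then have "[1 = (-1) ^ t] (mod ?Q)"
    using pell_multiple[OF m_re m_im, of t] pell_multiple[OF d, of "2 ^ (p - 1 - a)"]
    by (metis cong_sym cong_trans power_one)
  then have "?Q dvd 2" using at(2) by (simp add: cong_iff_dvd_diff)
  then have "q dvd 2" by (metis int_dvd_int_iff of_nat_numeral)
  then have "q \<le> 2" by (simp add: dvd_imp_le)
  with prime_ge_2_nat[OF q(1)] \<open>odd q\<close> show False by auto
qed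

section \<open>Closed form of the Quanta Prime Sequence\<close>

lemma quanta_prime_sum:
  fixes \<zeta> \<xi> :: "'a::comm_ring_1"
  assumes "odd (n - 1)"
  shows "quanta_prime r k \<zeta> \<xi> n =
    (\<Sum>i\<le>k. of_nat (k choose i) * ((2 * \<zeta> - \<xi>) ^ (k - i) * (- 2 * \<zeta>) ^ i
      * (\<Prod>j<i. of_nat n - 2 * of_nat r - 1 - 2 * of_nat j)
      * (\<Prod>j = Suc i..k. of_nat n - of_nat r - of_nat j)))"
proof (induction k arbitrary: r)
  case (Suc k)
  have pb: "parity_bit (n - 1) = 1"
    using assms by (simp only: parity_bit_def odd_iff_mod_2_eq_one)
  define \<alpha> where "\<alpha> = 2 * \<zeta> - \<xi>"
  define \<beta> where "\<beta> = - 2 * \<zeta>"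
  define A where "A = (\<lambda>r i. \<Prod>j<i. (of_nat n :: 'a) - 2 * of_nat r - 1 - 2 * of_nat j)"
  define B where "B = (\<lambda>r i k. \<Prod>j = Suc i..k. (of_nat n :: 'a) - of_nat r - of_nat j)"
  define T where "T = (\<lambda>r k i. \<alpha> ^ (k - i) * \<beta> ^ i * A r i * B r i k)"
  have IH: "quanta_prime r k \<zeta> \<xi> n = (\<Sum>i\<le>k. of_nat (k choose i) * T r k i)" for r
    unfolding T_def A_def B_def \<alpha>_def \<beta>_def by (rule Suc.IH)
  \<comment> \<open>Keeping \<open>r\<close> appends the last factor of \<open>B\<close>. Raising
    \<open>r\<close> prepends the first factor of \<open>A\<close>, while \<open>B\<close> is only
    reindexed. Pascal's rule matches these two branches of the recurrence.\<close>
  have shift_k: "T r (Suc k) i = \<alpha> * (of_nat n - of_nat r - of_nat (Suc k)) * T r k i"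
    if "i \<le> k" for i
    using that by (simp add: T_def B_def Suc_diff_le algebra_simps)
  have shift_r: "T r (Suc k) (Suc i) = \<beta> * (of_nat n - 2 * of_nat r - 1) * T (Suc r) k i" for i
  proof -
    have "A r (Suc i) = (of_nat n - 2 * of_nat r - 1) * A (Suc r) i"
      unfolding A_def by (subst prod.lessThan_Suc_shift) (simp add: algebra_simps)
    moreover have "B r (Suc i) (Suc k) = B (Suc r) i k"
      unfolding B_def by (subst prod.shift_bounds_cl_Suc_ivl) (simp add: algebra_simps)
    ultimately show ?thesis by (simp add: T_def)
  qed
  have "(\<Sum>i\<le>Suc k. of_nat (Suc k choose i) * T r (Suc k) i)
      = (\<Sum>i\<le>Suc k. of_nat (k choose i) * T r (Suc k) i)
        + (\<Sum>i\<le>k. of_nat (k choose i) * T r (Suc k) (Suc i))"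
    by (subst (1 2) sum.atMost_Suc_shift) (simp add: sum.distrib algebra_simps)
  also have "(\<Sum>i\<le>Suc k. of_nat (k choose i) * T r (Suc k) i)
      = (\<Sum>i\<le>k. of_nat (k choose i) * T r (Suc k) i)"
    by (simp add: binomial_eq_0)
  also have "\<dots> = \<alpha> * (of_nat n - of_nat r - of_nat (Suc k)) * quanta_prime r k \<zeta> \<xi> n"
    unfolding IH sum_distrib_left by (intro sum.cong) (simp_all add: shift_k mult_ac)
  also have "(\<Sum>i\<le>k. of_nat (k choose i) * T r (Suc k) (Suc i))
      = \<beta> * (of_nat n - 2 * of_nat r - 1) * quanta_prime (Suc r) k \<zeta> \<xi> n"
    unfolding IH sum_distrib_left by (intro sum.cong) (simp_all add: shift_r mult_ac)
  also have "\<alpha> * (of_nat n - of_nat r - of_nat (Suc k)) * quanta_prime r k \<zeta> \<xi> n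
      + \<beta> * (of_nat n - 2 * of_nat r - 1) * quanta_prime (Suc r) k \<zeta> \<xi> n
      = quanta_prime r (Suc k) \<zeta> \<xi> n"
    using pb by (simp add: \<alpha>_def \<beta>_def)
  finally show ?case unfolding T_def A_def B_def \<alpha>_def \<beta>_def by simp
qed simp

section \<open>Girard-Waring coefficients\<close>

text \<open>
  The Girard-Waring coefficient \<open>n/(n-i) C(n-i,i)\<close>, defined through the recurrence
  \<open>V(n+2) = s V(n+1) + t V(n)\<close> of the polynomial \<open>V(n) = (\<Sum>i. waring n i t\<^sup>i s\<^sup>n\<^sup>-\<^sup>2\<^sup>i)\<close>.
\<close>

fun waring :: "nat \<Rightarrow> nat \<Rightarrow> nat" where
  "waring 0 0 = 2"
| "waring 0 (Suc i) = 0"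
| "waring (Suc 0) 0 = 1"
| "waring (Suc 0) (Suc i) = 0"
| "waring (Suc (Suc n)) 0 = 1"
| "waring (Suc (Suc n)) (Suc i) = waring (Suc n) (Suc i) + waring n i"

lemma waring_0: "0 < n \<Longrightarrow> waring n 0 = 1"
  by (induction n "0::nat" rule: waring.induct) auto

lemma waring_eq_0: "n < 2 * i \<Longrightarrow> waring n i = 0"
  by (induction n i rule: waring.induct) auto

lemma waring_diag: "waring (2 * i) i = 2"
  by (induction i) (auto simp: waring_eq_0)

text \<open>The explicit formula with denominators cleared, derived from the recurrence.\<close>

lemma waring_fact:
  "\<lbrakk>0 < n; 2 * i \<le> n\<rbrakk> \<Longrightarrow> waring n i * fact i * fact (n - 2 * i) = n * fact (n - i - 1)"
proof (induction n i rule: waring.induct)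
  case (5 n)
  then show ?case by simp
next
  case (6 n i)
  show ?case
  \<comment> \<open>On the diagonal the first summand of the recurrence vanishes and its induction
    hypothesis does not apply; this case also contains \<open>n = 0\<close>.\<close>
  proof (cases "n = 2 * i")
    case True
    then show ?thesis by (simp add: waring_diag waring_eq_0)
  next
    case False
    with 6(4) obtain s where n: "n = 2 * i + s + 1"
      by (metis Suc_eq_plus1 add.commute add_Suc_right le_neq_implies_less less_imp_Suc_add
          mult_Suc_right nat_add_left_cancel_le add_2_eq_Suc)
    have 1: "waring (Suc n) (Suc i) * fact (Suc i) * fact s = (n + 1) * fact (i + s)"
      using 6(1) by (simp add: n)
    have 2: "waring n i * fact i * fact (Suc s) = n * fact (i + s)"
      using 6(2) by (simp add: n Suc_diff_le)
    have "waring (Suc (Suc n)) (Suc i) * fact (Suc i) * fact (Suc s)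
        = (waring (Suc n) (Suc i) * fact (Suc i) * fact s) * Suc s
          + (waring n i * fact i * fact (Suc s)) * Suc i"
      by (simp add: algebra_simps)
    also have "\<dots> = (n + 2) * fact (Suc (i + s))"
      unfolding 1 2 by (simp add: n algebra_simps)
    finally show ?thesis by (simp add: n)
  qed
qed simp_all

text \<open>These are V(2h) and V(2h+1)/s at s = \<surd>2, t = 1: the roots (\<surd>2 \<plusminus>
  \<surd>6)/2 have squares 2 \<plusminus> \<surd>3. The odd-indexed sum is carried along because the
  recurrence has order two.\<close>

lemma waring_sum:
  "(\<Sum>i\<le>h. int (waring (2 * h) i) * 2 ^ (h - i)) = 2 * re3 2 1 h \<and>
   (\<Sum>i\<le>h. int (waring (2 * h + 1) i) * 2 ^ (h - i)) = re3 2 1 h + 3 * im3 2 1 h"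
proof (induction h)
  case (Suc h)
  let ?S = "\<lambda>n h. \<Sum>i\<le>h. int (waring n i) * 2 ^ (h - i)"
  have step: "?S (Suc (Suc n)) (Suc h) = ?S (Suc n) (Suc h) + ?S n h" for n
    by (subst (1 2) sum.atMost_Suc_shift) (simp add: waring_0 sum.distrib algebra_simps)
  have "?S (2 * h + 1) (Suc h) = 2 * ?S (2 * h + 1) h"
    by (simp add: waring_eq_0 sum_distrib_left Suc_diff_le mult_ac)
  then have even: "?S (2 * Suc h) (Suc h) = 2 * re3 2 1 (Suc h)"
    using step[of "2 * h"] Suc by simp
  have "?S (2 * Suc h + 1) (Suc h) = ?S (2 * Suc h) (Suc h) + ?S (2 * h + 1) h"
    using step[of "2 * h + 1"] by simp
  with even Suc show ?case by simp
qed simp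

text \<open>The factors of (2h)!/(2h-2i)! split into the \<open>i\<close> odd ones and
  \<open>i\<close> even ones, the latter with product 2^i h!/(h-i)!.\<close>

lemma fact_odd_prod:
  "i \<le> h \<Longrightarrow> fact (2 * h - 2 * i) * (\<Prod>j<i. 2 * int h - 1 - 2 * int j) * 2 ^ i * fact h
    = fact (2 * h) * fact (h - i)"
proof (induction i)
  case (Suc i)
  define d where "d = h - Suc i"
  have h: "h = i + Suc d" using Suc.prems by (simp add: d_def)
  have "fact (2 * h - 2 * i) * (\<Prod>j<i. 2 * int h - 1 - 2 * int j) * 2 ^ i * fact h
      = (fact (2 * h) * fact (h - i) :: int)" using Suc by simp
  moreover have "fact (2 * h - 2 * i) = 2 * (int d + 1) * (2 * int d + 1) * fact (2 * d)"
    by (simp add: h algebra_simps)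
  moreover have "fact (h - i) = (int d + 1) * fact d" by (simp add: h algebra_simps)
  moreover have "(\<Prod>j<Suc i. 2 * int h - 1 - 2 * int j)
      = (2 * int d + 1) * (\<Prod>j<i. 2 * int h - 1 - 2 * int j)" by (simp add: h)
  ultimately have "(int d + 1) * (fact (2 * d) * (\<Prod>j<Suc i. 2 * int h - 1 - 2 * int j) * 2 ^ Suc i * fact h)
      = (int d + 1) * (fact (2 * h) * fact d)"
    by (simp only: power_Suc mult_ac)
  then have "fact (2 * d) * (\<Prod>j<Suc i. 2 * int h - 1 - 2 * int j) * 2 ^ Suc i * fact h
      = fact (2 * h) * (fact d :: int)"
    by (subst (asm) mult_cancel_left) auto
  moreover have "2 * h - 2 * Suc i = 2 * d" "h - Suc i = d" by (simp_all add: h)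
  ultimately show ?case by simp
qed simp

lemma fact_falling_prod:
  "i < n \<Longrightarrow> fact (n - i - 1) * (\<Prod>j = 1..i. int n - int j) = fact (n - 1)"
proof (induction i)
  case (Suc i)
  then obtain d where n: "n = Suc (Suc i) + d" using less_iff_Suc_add by auto
  show ?case using Suc by (simp add: n algebra_simps)
qed simp

text \<open>Multiplied by the nonzero \<open>?K\<close>, both sides become
  \<open>fact (2 * h) * fact (h - i)\<close>.\<close>

lemma waring_coefficient:
  assumes "0 < h" "i \<le> h"
  shows "2 ^ i * int (h choose i) * (\<Prod>j<i. 2 * int h - 1 - 2 * int j)
    = int (waring (2 * h) i) * (\<Prod>j = 1..i. 2 * int h - int j)" (is "?c * ?A = ?w * ?P")
proof -
  let ?K = "fact i * fact (h - i) * fact (2 * h - 2 * i) :: int"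
  have "int (fact i * fact (h - i) * (h choose i)) = int (fact h)"
    using binomial_fact_lemma[OF assms(2)] by presburger
  then have C: "fact i * fact (h - i) * int (h choose i) = fact h" by simp
  have "int (waring (2 * h) i * fact i * fact (2 * h - 2 * i)) = int (2 * h * fact (2 * h - i - 1))"
    using waring_fact[of "2 * h" i] assms by presburger
  then have W: "?w * fact i * fact (2 * h - 2 * i) = 2 * int h * fact (2 * h - i - 1)" by simp
  have P: "fact (2 * h - i - 1) * ?P = fact (2 * h - 1)"
    using fact_falling_prod[of i "2 * h"] assms by simp
  have F: "2 * int h * fact (2 * h - 1) = fact (2 * h)"
    using fact_reduce[of "2 * h", where ?'a = int] assms by simp
  have "?K * (?c * ?A) = (fact i * fact (h - i) * int (h choose i)) * fact (2 * h - 2 * i) * ?A * 2 ^ i"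
    by (simp only: mult_ac)
  also have "\<dots> = fact (2 * h) * fact (h - i)"
    unfolding C using fact_odd_prod[OF assms(2)] by (simp only: mult_ac)
  also have "\<dots> = fact (h - i) * (2 * int h * (fact (2 * h - i - 1) * ?P))"
    unfolding P F by (simp only: mult_ac)
  also have "\<dots> = fact (h - i) * (2 * int h * fact (2 * h - i - 1)) * ?P" by (simp only: mult_ac)
  also have "\<dots> = ?K * (?w * ?P)" unfolding W[symmetric] by (simp only: mult_ac)
  finally show ?thesis by simp
qed

section \<open>Evaluation at (1, 4) and the divisibility criterion\<close>

lemma quanta_prime_1_4:
  assumes "0 < h"
  shows "quanta_prime 0 h (1::int) 4 (2 * h)
    = (-1) ^ h * (2 * re3 2 1 h) * (\<Prod>j = 1..h. 2 * int h - int j)"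
proof -
  let ?P = "\<lambda>i k. \<Prod>j = Suc i..k. 2 * int h - int j"
  have "odd (2 * h - 1)" using assms by simp
  then have "quanta_prime 0 h (1::int) 4 (2 * h)
      = (\<Sum>i\<le>h. int (h choose i) * ((-2) ^ (h - i) * (-2) ^ i
        * (\<Prod>j<i. 2 * int h - 1 - 2 * int j) * ?P i h))"
    by (subst quanta_prime_sum) simp_all
  \<comment> \<open>Here \<alpha> = \<beta> = -2, so the sign is the same in all terms. Trading
    \<open>2 ^ i\<close> and the odd product for a Waring coefficient supplies the factors that
    complete \<open>?P i h\<close> to \<open>?P 0 h\<close>.\<close>
  also have "\<dots> = (\<Sum>i\<le>h. (-1) ^ h * (int (waring (2 * h) i) * 2 ^ (h - i)) * ?P 0 h)"
  proof (rule sum.cong)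
    fix i assume "i \<in> {..h}"
    then have i: "i \<le> h" by simp
    have "(-2) ^ (h - i) * (-2) ^ i = (-2::int) ^ h" using i by (simp flip: power_add)
    also have "\<dots> = (-1) ^ h * 2 ^ h" by (simp add: power_minus[of 2])
    also have "\<dots> = (-1) ^ h * (2 ^ (h - i) * 2 ^ i)" using i by (simp flip: power_add)
    finally have pw: "(-2) ^ (h - i) * (-2) ^ i = (-1) ^ h * (2 ^ (h - i) * (2::int) ^ i)" .
    have P: "?P 0 h = ?P 0 i * ?P i h"
      using prod.ub_add_nat[of 1 i "\<lambda>j. 2 * int h - int j" "h - i"] i by simp
    have "int (h choose i) * ((-2) ^ (h - i) * (-2) ^ i * (\<Prod>j<i. 2 * int h - 1 - 2 * int j) * ?P i h)
        = (-1) ^ h * 2 ^ (h - i) * (2 ^ i * int (h choose i) * (\<Prod>j<i. 2 * int h - 1 - 2 * int j)) * ?P i h"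
      unfolding pw by (simp only: mult_ac)
    also have "\<dots> = (-1) ^ h * (int (waring (2 * h) i) * 2 ^ (h - i)) * ?P 0 h"
      unfolding waring_coefficient[OF assms i] P by (simp only: mult_ac One_nat_def)
    finally show "int (h choose i) * ((-2) ^ (h - i) * (-2) ^ i * (\<Prod>j<i. 2 * int h - 1 - 2 * int j) * ?P i h)
        = (-1) ^ h * (int (waring (2 * h) i) * 2 ^ (h - i)) * ?P 0 h" .
  qed simp
  also have "\<dots> = (-1) ^ h * (2 * re3 2 1 h) * ?P 0 h"
    using waring_sum[of h] by (simp only: sum_distrib_left[symmetric] sum_distrib_right[symmetric])
  finally show ?thesis by simp
qed

theorem theorem48:
  fixes p n :: nat
  assumes "prime p" and "p \<ge> 5" and "n = 2 ^ (p - 1)"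
  shows "(\<Prod>j = 1..n div 2. int n - int j) dvd quanta_prime 0 (n div 2) (1::int) 4 n \<and>
         (prime (2 ^ p - 1 :: nat) \<longleftrightarrow>
           2 * int n - 1 dvd
             quanta_prime 0 (n div 2) (1::int) 4 n div (\<Prod>j = 1..n div 2. int n - int j))"
proof -
  define h where "h = (2::nat) ^ (p - 2)"
  have n: "n = 2 * h"
    using assms by (simp add: h_def Suc_diff_le flip: power_Suc)
  have h0: "0 < h" by (simp add: h_def)
  let ?P = "\<Prod>j = 1..h. 2 * int h - int j"
  have P0: "?P \<noteq> 0" using h0 by auto
  have "quanta_prime 0 h (1::int) 4 n = ((-1) ^ h * (2 * re3 2 1 h)) * ?P"
    using quanta_prime_1_4[OF h0] n by simp
  then have dvd: "?P dvd quanta_prime 0 h (1::int) 4 n"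
    and ratio: "quanta_prime 0 h (1::int) 4 n div ?P = (-1) ^ h * (2 * re3 2 1 h)"
    using P0 by simp_all
  have "p = Suc (Suc (p - 2))" using assms(2) by simp
  then have "2 ^ p = 2 * (2 * h)" unfolding h_def by (metis power_Suc)
  then have M: "2 * int n - 1 = int (2 ^ p - 1)" using h0 by (simp add: n of_nat_diff)
  have "odd p" using assms prime_odd_nat by auto
  \<comment> \<open>The modulus is odd, so the sign and the factor 2 do not affect
    divisibility.\<close>
  have "coprime (2 * int n - 1) ((-1) ^ h * 2)"
    by (simp add: coprime_right_2_iff_odd coprime_commute is_unit_right_imp_coprime)
  then have "2 * int n - 1 dvd (-1) ^ h * (2 * re3 2 1 h) \<longleftrightarrow> 2 * int n - 1 dvd re3 2 1 h"
    by (simp add: coprime_dvd_mult_right_iff flip: mult.assoc)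
  also have "\<dots> \<longleftrightarrow> prime (2 ^ p - 1 :: nat)"
    using lucas_lehmer_necessary[OF _ refl assms(1) \<open>odd p\<close>] lucas_lehmer_sufficient[of p] assms(2)
    unfolding M h_def by auto
  finally show ?thesis using dvd ratio by (simp add: n)
qed

end
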